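(* Let $G$ be a connected finite simple graph with maximum degree $\Delta\ge 2$ that is not isomorphic to the cycle $C_7$. Then $\chi'_{(0,1)}(G)\le \Delta^2-1$.
   Context: All graphs are finite, simple and undirected. Two distinct edges $e,f$ are at distance $1$ if they share an endvertex; they are at distance $2$ if they share no endvertex but some edge of $G$ is adjacent to (shares an endvertex with) both of them. For nonnegative integers $s,t,k$, an $(s,t)$-relaxed strong $k$-edge-coloring of $G$ is an assignment of at most $k$ colors to the edges of $G$ such that for each edge $e$, at most $s$ edges at distance $1$ from $e$ and at most $t$ edges at distance $2$ from $e$ receive the same color as $e$. The $(s,t)$-relaxed strong chromatic index $\chi'_{(s,t)}(G)$ is the least $k$ for which such a coloring exists. $C_n$ denotes the cycle on $n$ vertices. *)

theory Defs
  imports Main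
begin

definition simple_graph :: "'a set \<Rightarrow> 'a set set \<Rightarrow> bool" where
  "simple_graph V E \<longleftrightarrow> finite V \<and>
     (\<forall>e\<in>E. \<exists>u v. u \<in> V \<and> v \<in> V \<and> u \<noteq> v \<and> e = {u, v})"

definition connected_graph :: "'a set \<Rightarrow> 'a set set \<Rightarrow> bool" where
  "connected_graph V E \<longleftrightarrow> V \<noteq> {} \<and>
     (\<forall>u\<in>V. \<forall>v\<in>V. (\<lambda>x y. {x, y} \<in> E)\<^sup>*\<^sup>* u v)"

definition degree :: "'a set set \<Rightarrow> 'a \<Rightarrow> nat" where
  "degree E v = card {e \<in> E. v \<in> e}"

definition max_degree :: "'a set \<Rightarrow> 'a set set \<Rightarrow> nat" where
  "max_degree V E = Max (degree E ` V)"

definition edge_dist1 :: "'a set \<Rightarrow> 'a set \<Rightarrow> bool" where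
  "edge_dist1 e f \<longleftrightarrow> e \<noteq> f \<and> e \<inter> f \<noteq> {}"

definition edge_dist2 :: "'a set set \<Rightarrow> 'a set \<Rightarrow> 'a set \<Rightarrow> bool" where
  "edge_dist2 E e f \<longleftrightarrow> e \<noteq> f \<and> e \<inter> f = {} \<and>
     (\<exists>g\<in>E. g \<inter> e \<noteq> {} \<and> g \<inter> f \<noteq> {})"

definition relaxed_strong_coloring ::
  "'a set set \<Rightarrow> nat \<Rightarrow> nat \<Rightarrow> nat \<Rightarrow> ('a set \<Rightarrow> nat) \<Rightarrow> bool" where
  "relaxed_strong_coloring E s t k c \<longleftrightarrow>
     (\<forall>e\<in>E. c e < k) \<and>
     (\<forall>e\<in>E. card {f \<in> E. edge_dist1 e f \<and> c f = c e} \<le> s \<and>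
             card {f \<in> E. edge_dist2 E e f \<and> c f = c e} \<le> t)"

definition relaxed_strong_chromatic_index :: "'a set set \<Rightarrow> nat \<Rightarrow> nat \<Rightarrow> nat" where
  "relaxed_strong_chromatic_index E s t =
     (LEAST k. \<exists>c. relaxed_strong_coloring E s t k c)"

definition cycle_edges :: "nat \<Rightarrow> nat set set" where
  "cycle_edges n = {{i, (i + 1) mod n} | i. i < n}"

definition graph_iso :: "'a set \<Rightarrow> 'a set set \<Rightarrow> 'b set \<Rightarrow> 'b set set \<Rightarrow> bool" where
  "graph_iso V E W F \<longleftrightarrow> (\<exists>f. bij_betw f V W \<and>
     (\<forall>u\<in>V. \<forall>v\<in>V. {u, v} \<in> E \<longleftrightarrow> {f u, f v} \<in> F))"

definition isomorphic_to_cycle :: "'a set \<Rightarrow> 'a set set \<Rightarrow> nat \<Rightarrow> bool" where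
  "isomorphic_to_cycle V E n \<longleftrightarrow> graph_iso V E {0..<n} (cycle_edges n)"

end

theory Submission
  imports Defs
begin

text \<open>Give conflicts weight 2 at distance 1 and weight 1 at distance 2. An edge then sees total weight at most
  \<open>2(\<Delta>\<^sup>2 - 1)\<close>, and it is satisfied iff its own color costs less than 2. If there is no valid coloring with
  \<open>k = \<Delta>\<^sup>2 - 1\<close> colors, take one of minimum total conflict: at an unsatisfied edge (a hole) every color costs
  exactly 2, so the hole may take the color of any adjacent edge, which becomes a hole in turn. Since \<open>G\<close> is
  connected, holes can be moved everywhere, every edge sees weight exactly \<open>2k\<close>, and therefore \<open>G\<close> is
  \<open>\<Delta>\<close>-regular of girth at least 5. Let \<open>e\<^sub>0, \<dots>, e\<^bsub>m-1\<^esub>\<close> be a shortest cycle with a hole at \<open>e\<^sub>0\<close>. Sending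
  the hole once around the cycle shows that \<open>e\<^sub>2\<close> and \<open>e\<^bsub>m-2\<^esub>\<close> have the same color. If \<open>\<Delta> \<ge> 3\<close>, some edge
  \<open>g\<close> off the cycle meets \<open>e\<^sub>1\<close> and \<open>e\<^sub>2\<close> in their common vertex, and the hole walk
  \<open>e\<^sub>0, e\<^sub>1, e\<^sub>2, g, e\<^sub>1, e\<^sub>0\<close> swaps the colors of \<open>e\<^sub>2\<close> and \<open>g\<close> and otherwise
  recolors only the hole, a contradiction. If \<open>\<Delta> = 2\<close>, then \<open>G\<close> is
  a cycle and an explicit 3-coloring exists unless \<open>m = 7\<close>.\<close>

subsection \<open>Colorings of minimum conflict\<close>

locale weighted_coloring =
  fixes E :: "'b set" and w :: "'b \<Rightarrow> 'b \<Rightarrow> nat" and k :: nat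
  assumes finite_E: "finite E"
    and w_sym: "w e f = w f e"
    and w_self [simp]: "w e e = 0"
    and w_total: "e \<in> E \<Longrightarrow> (\<Sum>f\<in>E. w e f) \<le> 2 * k"
begin

text \<open>Independent of \<open>\<phi> e\<close> because \<open>w e e = 0\<close>: this is what
  \<open>e\<close> would pay for color \<open>c\<close>, whatever its present color.\<close>

definition cost :: "('b \<Rightarrow> nat) \<Rightarrow> 'b \<Rightarrow> nat \<Rightarrow> nat" where
  "cost \<phi> e c = (\<Sum>f\<in>E. if \<phi> f = c then w e f else 0)"

definition potential :: "('b \<Rightarrow> nat) \<Rightarrow> nat" where
  "potential \<phi> = (\<Sum>e\<in>E. cost \<phi> e (\<phi> e))"

text \<open>Validity and global minimality of \<open>\<phi>\<close> are included so that a moved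
  hole is again a hole and moves can be iterated.\<close>

definition hole :: "('b \<Rightarrow> nat) \<Rightarrow> 'b \<Rightarrow> bool" where
  "hole \<phi> e \<longleftrightarrow> e \<in> E \<and> \<phi> ` E \<subseteq> {..<k} \<and>
     (\<forall>\<psi>. \<psi> ` E \<subseteq> {..<k} \<longrightarrow> potential \<phi> \<le> potential \<psi>) \<and> 2 \<le> cost \<phi> e (\<phi> e)"

lemma hole_in: "hole \<phi> e \<Longrightarrow> e \<in> E"
  and hole_lt: "hole \<phi> e \<Longrightarrow> f \<in> E \<Longrightarrow> \<phi> f < k"
  by (auto simp: hole_def)

lemma cost_remove:
  assumes "e \<in> E"
  shows "cost \<phi> g c = (\<Sum>f\<in>E-{e}. if \<phi> f = c then w g f else 0) + (if \<phi> e = c then w g e else 0)"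
  unfolding cost_def using assms finite_E by (subst sum.remove[of E e]) auto

lemma cost_self_update [simp]: "cost (\<phi>(e := c)) e d = cost \<phi> e d"
  unfolding cost_def by (intro sum.cong) auto

lemma sum_cost:
  assumes "\<phi> ` E \<subseteq> {..<k}"
  shows "(\<Sum>c<k. cost \<phi> e c) = (\<Sum>f\<in>E. w e f)"
proof -
  have "(\<Sum>c<k. cost \<phi> e c) = (\<Sum>f\<in>E. \<Sum>c<k. if \<phi> f = c then w e f else 0)"
    unfolding cost_def by (rule sum.swap)
  also have "\<dots> = (\<Sum>f\<in>E. w e f)"
    using assms by (intro sum.cong) auto
  finally show ?thesis .
qed

text \<open>By symmetry of \<open>w\<close>, each pair containing \<open>e\<close> is counted from
  both ends, hence the factor 2. The remaining double sum ignores the color of \<open>e\<close>, so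
  it cancels in \<open>potential_update\<close>.\<close>

lemma potential_split:
  assumes "e \<in> E"
  shows "potential \<phi> = 2 * cost \<phi> e (\<phi> e) + (\<Sum>g\<in>E-{e}. \<Sum>f\<in>E-{e}. if \<phi> f = \<phi> g then w g f else 0)"
proof -
  have "(if \<phi> e = \<phi> g then w g e else 0) = (if \<phi> g = \<phi> e then w e g else 0)" for g
    using w_sym[of e g] by auto
  then have "(\<Sum>g\<in>E-{e}. if \<phi> e = \<phi> g then w g e else 0) = cost \<phi> e (\<phi> e)"
    unfolding cost_remove[OF assms, of \<phi> e "\<phi> e"] by simp
  moreover have "potential \<phi> = cost \<phi> e (\<phi> e) + (\<Sum>g\<in>E-{e}. cost \<phi> g (\<phi> g))"
    unfolding potential_def using assms finite_E by (rule sum.remove[rotated])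
  moreover have "(\<Sum>g\<in>E-{e}. cost \<phi> g (\<phi> g)) =
      (\<Sum>g\<in>E-{e}. \<Sum>f\<in>E-{e}. if \<phi> f = \<phi> g then w g f else 0) +
      (\<Sum>g\<in>E-{e}. if \<phi> e = \<phi> g then w g e else 0)"
    unfolding cost_remove[OF assms] by (rule sum.distrib)
  ultimately show ?thesis by simp
qed

lemma potential_update:
  assumes "e \<in> E"
  shows "potential (\<phi>(e := c)) + 2 * cost \<phi> e (\<phi> e) = potential \<phi> + 2 * cost \<phi> e c"
proof -
  have "(\<Sum>g\<in>E-{e}. \<Sum>f\<in>E-{e}. if (\<phi>(e := c)) f = (\<phi>(e := c)) g then w g f else 0) =
        (\<Sum>g\<in>E-{e}. \<Sum>f\<in>E-{e}. if \<phi> f = \<phi> g then w g f else 0)"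
    by (intro sum.cong refl) auto
  then show ?thesis
    unfolding potential_split[OF assms] by simp
qed

lemma ex_hole:
  assumes "k > 0" and "\<And>\<phi>. \<phi> ` E \<subseteq> {..<k} \<Longrightarrow> \<exists>e\<in>E. 2 \<le> cost \<phi> e (\<phi> e)"
  shows "\<exists>\<phi> e. hole \<phi> e"
proof -
  have "(\<lambda>_. 0) ` E \<subseteq> {..<k}" using assms(1) by auto
  then obtain \<phi> where "\<phi> ` E \<subseteq> {..<k}" "\<forall>\<psi>. \<psi> ` E \<subseteq> {..<k} \<longrightarrow> potential \<phi> \<le> potential \<psi>"
    using ex_has_least_nat[of "\<lambda>\<phi>. \<phi> ` E \<subseteq> {..<k}" "\<lambda>_. 0" potential] by metis
  then show ?thesis using assms(2)[of \<phi>] by (auto simp: hole_def)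
qed

text \<open>Recoloring \<open>e\<close> changes the potential by twice the difference of its costs,
  so at a minimum no color is cheaper than the present one.\<close>

lemma hole_cost_ge:
  assumes "hole \<phi> e" "c < k"
  shows "2 \<le> cost \<phi> e c"
proof -
  have "(\<phi>(e := c)) ` E \<subseteq> {..<k}" using assms by (auto simp: hole_def)
  then have "potential \<phi> \<le> potential (\<phi>(e := c))" using assms(1) by (simp add: hole_def)
  then show ?thesis
    using potential_update[OF hole_in[OF assms(1)], of \<phi> c] assms(1) by (simp add: hole_def)
qed

text \<open>Averaging: each of the \<open>k\<close> colors costs at least 2, while all together cost
  at most \<open>2 * k\<close>.\<close>

lemma hole_tight:
  assumes "hole \<phi> e"
  shows "(\<Sum>f\<in>E. w e f) = 2 * k" and "\<And>c. c < k \<Longrightarrow> cost \<phi> e c = 2"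
proof -
  have *: "(\<Sum>c<k. cost \<phi> e c) = (\<Sum>f\<in>E. w e f)"
    using assms by (intro sum_cost) (simp add: hole_def)
  have ge: "(\<Sum>c<k. 2) \<le> (\<Sum>c<k. cost \<phi> e c)"
    using hole_cost_ge[OF assms] by (intro sum_mono) auto
  moreover have "(\<Sum>c<k. cost \<phi> e c) \<le> 2 * k"
    unfolding * by (rule w_total[OF hole_in[OF assms]])
  ultimately have eq: "(\<Sum>c<k. cost \<phi> e c) = (\<Sum>c<k. 2)" by simp
  then show "(\<Sum>f\<in>E. w e f) = 2 * k" using * by simp
  fix c assume "c < k"
  then show "cost \<phi> e c = 2"
    using sum_mono_inv[OF eq[symmetric]] hole_cost_ge[OF assms] by force
qed

text \<open>All colors cost 2 at the hole, so the new coloring is still minimal; \<open>f\<close>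
  now pays 2 for \<open>e\<close> alone.\<close>

lemma hole_move:
  assumes "hole \<phi> e" "f \<in> E" "w e f = 2"
  shows "hole (\<phi>(e := \<phi> f)) f"
proof -
  let ?\<psi> = "\<phi>(e := \<phi> f)"
  have "e \<in> E" and "e \<noteq> f" and lt: "\<phi> f < k" using assms by (auto simp: hole_def)
  have "potential ?\<psi> = potential \<phi>"
    using potential_update[OF \<open>e \<in> E\<close>, of \<phi> "\<phi> f"] hole_tight(2)[OF assms(1)] lt
      hole_lt[OF assms(1) \<open>e \<in> E\<close>] by simp
  moreover have "2 \<le> cost ?\<psi> f (\<phi> f)"
    unfolding cost_remove[OF \<open>e \<in> E\<close>] using assms(3) by (simp add: w_sym[of f])
  moreover have "?\<psi> ` E \<subseteq> {..<k}" using assms by (auto simp: hole_def)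
  ultimately show ?thesis using assms \<open>e \<noteq> f\<close> by (simp add: hole_def)
qed

text \<open>The sum is part of the cost of \<open>c\<close>, which is 2 at a hole. A member of
  \<open>A\<close> witnesses that \<open>c\<close> is among the \<open>k\<close> colors.\<close>

lemma hole_weight_le:
  assumes "hole \<phi> e" "A \<subseteq> E" "\<And>f. f \<in> A \<Longrightarrow> \<phi> f = c" "A \<noteq> {}"
  shows "(\<Sum>f\<in>A. w e f) \<le> 2"
proof -
  have "(\<Sum>f\<in>A. w e f) = (\<Sum>f\<in>A. if \<phi> f = c then w e f else 0)"
    using assms by (intro sum.cong) auto
  also have "\<dots> \<le> cost \<phi> e c"
    unfolding cost_def using assms finite_E by (intro sum_mono2) auto
  also have "\<dots> = 2"
    using assms by (intro hole_tight) (auto dest: hole_lt)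
  finally show ?thesis .
qed

end

subsection \<open>Conflict weights in graphs\<close>

text \<open>One summand for each endpoint of an edge; truncated subtraction does no harm at
  \<open>n = 0\<close>.\<close>

lemma square_minus_one_nat: "2 * (n\<^sup>2 - 1) = (n - 1) * (n + 1) + (n - 1) * (n + 1 :: nat)"
proof -
  have "n\<^sup>2 - 1 = (n - 1) * (n + 1)" by (simp add: power2_eq_square algebra_simps)
  then show ?thesis by simp
qed

definition edge_weight :: "'a set set \<Rightarrow> 'a set \<Rightarrow> 'a set \<Rightarrow> nat" where
  "edge_weight E e f = (if edge_dist1 e f then 2 else if edge_dist2 E e f then 1 else 0)"

definition nbrs :: "'a set set \<Rightarrow> 'a \<Rightarrow> 'a set" where
  "nbrs E u = {x. {u, x} \<in> E}"

lemma in_nbrs_iff [simp]: "x \<in> nbrs E u \<longleftrightarrow> {u, x} \<in> E"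
  by (simp add: nbrs_def)

lemma edge_weight_sym: "edge_weight E e f = edge_weight E f e"
proof -
  have "edge_dist1 e f = edge_dist1 f e" "edge_dist2 E e f = edge_dist2 E f e"
    unfolding edge_dist1_def edge_dist2_def by blast+
  then show ?thesis by (simp add: edge_weight_def)
qed

lemma edge_weight_self [simp]: "edge_weight E e e = 0"
  unfolding edge_weight_def edge_dist1_def edge_dist2_def by simp

lemma edge_weight_adjacent: "e \<noteq> f \<Longrightarrow> x \<in> e \<Longrightarrow> x \<in> f \<Longrightarrow> edge_weight E e f = 2"
  unfolding edge_weight_def edge_dist1_def by auto

locale finite_graph =
  fixes V :: "'a set" and E :: "'a set set"
  assumes simple: "simple_graph V E"
begin

lemma edge_cases:
  assumes "e \<in> E" "u \<in> e"
  obtains v where "e = {u, v}" "u \<noteq> v"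
  using assms simple unfolding simple_graph_def by fast

lemma edge_ends: "{u, v} \<in> E \<Longrightarrow> u \<noteq> v \<and> u \<in> V \<and> v \<in> V"
  using simple unfolding simple_graph_def by (metis doubleton_eq_iff)

lemma finite_edges: "finite E"
proof -
  have "E \<subseteq> Pow V" using simple unfolding simple_graph_def by auto
  then show ?thesis using simple finite_subset by (fastforce simp: simple_graph_def)
qed

lemma finite_nbrs [simp]: "finite (nbrs E u)"
proof -
  have "nbrs E u \<subseteq> V" using edge_ends by auto
  then show ?thesis using simple finite_subset by (fastforce simp: simple_graph_def)
qed

lemma card_nbrs: "card (nbrs E u) = degree E u"
proof -
  have "{e \<in> E. u \<in> e} = (\<lambda>x. {u, x}) ` nbrs E u"
  proof (intro equalityI subsetI)
    fix e assume "e \<in> {e \<in> E. u \<in> e}"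
    then obtain x where "e = {u, x}" "e \<in> E" by (auto elim: edge_cases)
    then show "e \<in> (\<lambda>x. {u, x}) ` nbrs E u" by auto
  qed auto
  moreover have "inj_on (\<lambda>x. {u, x}) (nbrs E u)"
    by (auto intro!: inj_onI simp: doubleton_eq_iff)
  ultimately show ?thesis by (simp add: degree_def card_image)
qed

lemma degree_le: "u \<in> V \<Longrightarrow> degree E u \<le> max_degree V E"
  using simple unfolding max_degree_def simple_graph_def by auto

lemma relaxed_strong_coloring_if_light:
  assumes "c ` E \<subseteq> {..<k}"
    and "\<And>e. e \<in> E \<Longrightarrow> (\<Sum>f\<in>E. if c f = c e then edge_weight E e f else 0) < 2"
  shows "relaxed_strong_coloring E 0 1 k c"
  unfolding relaxed_strong_coloring_def
proof (intro conjI ballI)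
  fix e assume "e \<in> E"
  let ?A = "{f \<in> E. edge_dist1 e f \<and> c f = c e}" and ?B = "{f \<in> E. edge_dist2 E e f \<and> c f = c e}"
  have "(\<Sum>f\<in>E. if c f = c e then edge_weight E e f else 0) =
      (\<Sum>f\<in>E. (if edge_dist1 e f \<and> c f = c e then 2 else 0) +
        (if edge_dist2 E e f \<and> c f = c e then 1 else 0))"
    by (intro sum.cong) (auto simp: edge_weight_def edge_dist1_def edge_dist2_def)
  also have "\<dots> = 2 * card ?A + card ?B"
    by (simp add: sum.distrib sum.inter_filter[OF finite_edges, symmetric])
  finally have "2 * card ?A + card ?B < 2" using assms(2)[OF \<open>e \<in> E\<close>] by simp
  then show "card ?A \<le> 0" "card ?B \<le> 1" by auto
  show "c e < k" using assms(1) \<open>e \<in> E\<close> by auto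
qed

text \<open>Counts \<open>f\<close> as often as it is reached from \<open>{u, v}\<close> through \<open>u\<close>. Triangles and 4-cycles through
  \<open>{u, v}\<close> make this exceed the weight, which is why tight edges lie on no such cycle.\<close>

definition sight :: "'a \<Rightarrow> 'a \<Rightarrow> 'a set \<Rightarrow> nat" where
  "sight u v f = (\<Sum>x\<in>nbrs E u - {v}. (if x \<in> f then 1 else 0) + (if f = {u, x} then 1 else 0))"

lemma sight_ge:
  assumes "{u, x} \<in> E" "x \<noteq> v" "x \<in> f"
  shows "1 \<le> sight u v f" and "f = {u, x} \<Longrightarrow> 2 \<le> sight u v f"
proof -
  have *: "(if x \<in> f then 1 else 0) + (if f = {u, x} then 1 else 0) \<le> sight u v f"
    unfolding sight_def using assms by (intro member_le_sum[of x]) auto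
  then show "1 \<le> sight u v f" using assms by simp
  show "2 \<le> sight u v f" if "f = {u, x}" using * that by simp
qed

text \<open>An adjacent edge \<open>{u, x}\<close> is counted twice from \<open>u\<close>, once for
  containing \<open>x\<close> and once for being \<open>{u, x}\<close>. An edge at distance 2 is
  counted at the far end of the connecting edge.\<close>

lemma edge_weight_le_sight:
  assumes "{u, v} \<in> E" "f \<in> E"
  shows "edge_weight E {u, v} f \<le> sight u v f + sight v u f"
proof -
  have aux: "2 \<le> sight u v f" if "{u, v} \<noteq> f" "u \<in> f" for u v
  proof -
    obtain x where "f = {u, x}" using assms(2) \<open>u \<in> f\<close> by (rule edge_cases)
    then show ?thesis using that assms(2) by (intro sight_ge(2)[of u x]) auto
  qed
  have aux2: "1 \<le> sight u v f" if "u \<notin> f" "v \<notin> f" "g \<in> E" "u \<in> g" "g \<inter> f \<noteq> {}" for u v g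
  proof -
    obtain x where "g = {u, x}" using \<open>g \<in> E\<close> \<open>u \<in> g\<close> by (auto elim: edge_cases)
    then show ?thesis using that by (intro sight_ge(1)[of u x]) auto
  qed
  consider "edge_dist1 {u, v} f" | "\<not> edge_dist1 {u, v} f" "edge_dist2 E {u, v} f"
    | "\<not> edge_dist1 {u, v} f" "\<not> edge_dist2 E {u, v} f" by blast
  then show ?thesis
  proof cases
    case 1
    then have "{u, v} \<noteq> f" "{v, u} \<noteq> f" "u \<in> f \<or> v \<in> f" by (auto simp: edge_dist1_def)
    then show ?thesis using aux[of u v] aux[of v u] 1 by (auto simp: edge_weight_def)
  next
    case 2
    then obtain g where "g \<in> E" "u \<in> g \<or> v \<in> g" "g \<inter> f \<noteq> {}" "u \<notin> f" "v \<notin> f"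
      by (auto simp: edge_dist2_def)
    then show ?thesis using aux2[of u v g] aux2[of v u g] 2 by (auto simp: edge_weight_def)
  next
    case 3
    then show ?thesis by (simp add: edge_weight_def)
  qed
qed

text \<open>Double counting: \<open>x\<close> is hit by its \<open>degree E x\<close> edges, and
  \<open>{u, x}\<close> counts once more.\<close>

lemma sum_sight: "(\<Sum>f\<in>E. sight u v f) = (\<Sum>x\<in>nbrs E u - {v}. degree E x + 1)"
proof -
  have "(\<Sum>f\<in>E. sight u v f) = (\<Sum>x\<in>nbrs E u - {v}.
      \<Sum>f\<in>E. (if x \<in> f then 1 else 0) + (if f = {u, x} then 1 else 0))"
    unfolding sight_def by (rule sum.swap)
  also have "\<dots> = (\<Sum>x\<in>nbrs E u - {v}. degree E x + 1)"
    using finite_edges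
    by (intro sum.cong refl) (simp add: sum.distrib sum.If_cases degree_def Int_def)
  finally show ?thesis .
qed

lemma sum_sight_le:
  assumes "{u, v} \<in> E"
  shows "(\<Sum>f\<in>E. sight u v f) \<le> (degree E u - 1) * (max_degree V E + 1)"
proof -
  have "(\<Sum>f\<in>E. sight u v f) \<le> (\<Sum>x\<in>nbrs E u - {v}. max_degree V E + 1)"
    unfolding sum_sight using edge_ends degree_le by (intro sum_mono) auto
  also have "\<dots> = (degree E u - 1) * (max_degree V E + 1)"
    using assms by (simp add: card_nbrs)
  finally show ?thesis .
qed

lemma sum_edge_weight_le:
  assumes "e \<in> E"
  shows "(\<Sum>f\<in>E. edge_weight E e f) \<le> 2 * ((max_degree V E)\<^sup>2 - 1)"
proof -
  obtain u v where e: "e = {u, v}" using assms simple unfolding simple_graph_def by blast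
  have uv: "{u, v} \<in> E" "{v, u} \<in> E" using assms e by (auto simp: insert_commute)
  have bd: "(degree E x - 1) * (max_degree V E + 1) \<le> (max_degree V E - 1) * (max_degree V E + 1)"
    if "x \<in> V" for x
    using degree_le[OF that] by (intro mult_right_mono) auto
  have "(\<Sum>f\<in>E. edge_weight E e f) \<le> (\<Sum>f\<in>E. sight u v f + sight v u f)"
    unfolding e by (intro sum_mono edge_weight_le_sight uv)
  also have "\<dots> \<le> 2 * ((max_degree V E)\<^sup>2 - 1)"
    unfolding square_minus_one_nat sum.distrib
    using sum_sight_le uv bd edge_ends by (meson add_mono order_trans)
  finally show ?thesis .
qed

text \<open>Every inequality behind the weight bound becomes an equality. A triangle would let
  \<open>{u, x}\<close> be counted 3 times, but no weight exceeds 2; in a 4-cycle the opposite edge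
  would be counted from both sides, but its weight is at most 1.\<close>

lemma tight_edge:
  assumes uv: "{u, v} \<in> E" and tight: "(\<Sum>f\<in>E. edge_weight E {u, v} f) = 2 * ((max_degree V E)\<^sup>2 - 1)"
    and "max_degree V E \<ge> 2"
  shows "degree E u = max_degree V E"
    and "{u, x} \<in> E \<Longrightarrow> {v, x} \<notin> E"
    and "{u, x} \<in> E \<Longrightarrow> {v, y} \<in> E \<Longrightarrow> x \<noteq> v \<Longrightarrow> y \<noteq> u \<Longrightarrow> {x, y} \<notin> E"
proof -
  let ?D = "max_degree V E"
  have vu: "{v, u} \<in> E" using uv by (simp add: insert_commute)
  have V: "u \<in> V" "v \<in> V" "u \<noteq> v" using edge_ends[OF uv] by auto
  have le: "(\<Sum>f\<in>E. edge_weight E {u, v} f) \<le> (\<Sum>f\<in>E. sight u v f + sight v u f)"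
    by (intro sum_mono edge_weight_le_sight uv)
  have "(\<Sum>f\<in>E. sight v u f) \<le> (?D - 1) * (?D + 1)"
    using sum_sight_le[OF vu] degree_le[OF V(2)] by (meson diff_le_mono le_trans mult_le_mono1)
  moreover have u: "(\<Sum>f\<in>E. sight u v f) \<le> (degree E u - 1) * (?D + 1)"
    by (rule sum_sight_le[OF uv])
  moreover have u2: "(degree E u - 1) * (?D + 1) \<le> (?D - 1) * (?D + 1)"
    using degree_le[OF V(1)] by (intro mult_right_mono) auto
  ultimately have "(?D - 1) * (?D + 1) \<le> (degree E u - 1) * (?D + 1)"
    and eq: "(\<Sum>f\<in>E. edge_weight E {u, v} f) = (\<Sum>f\<in>E. sight u v f + sight v u f)"
    using le tight unfolding square_minus_one_nat sum.distrib by linarith+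
  then have "?D - 1 \<le> degree E u - 1" by (simp only: mult_le_cancel2)
  then show "degree E u = ?D" using degree_le[OF V(1)] assms(3) by linarith
  \<comment> \<open>Equal sums with termwise inequality force equality in each term.\<close>
  have pt: "edge_weight E {u, v} f = sight u v f + sight v u f" if "f \<in> E" for f
    using sum_mono_inv[OF eq _ that finite_edges] edge_weight_le_sight[OF uv] by blast
  show "{v, x} \<notin> E" if ux: "{u, x} \<in> E"
  proof
    assume "{v, x} \<in> E"
    then have "x \<noteq> u" "x \<noteq> v" using ux edge_ends by blast+
    then have "3 \<le> edge_weight E {u, v} {u, x}"
      using sight_ge(2)[OF ux, of v "{u, x}"] sight_ge(1)[OF \<open>{v, x} \<in> E\<close>, of u "{u, x}"]
      unfolding pt[OF ux] by simp
    then show False by (simp add: edge_weight_def split: if_splits)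
  qed
  show "{x, y} \<notin> E" if "{u, x} \<in> E" "{v, y} \<in> E" "x \<noteq> v" "y \<noteq> u"
  proof
    assume xy: "{x, y} \<in> E"
    have "x \<noteq> u" "y \<noteq> v" using that edge_ends by blast+
    then have "edge_weight E {u, v} {x, y} \<le> 1"
      using that by (auto simp: edge_weight_def edge_dist1_def)
    moreover have "2 \<le> edge_weight E {u, v} {x, y}"
      using sight_ge(1)[OF that(1,3), of "{x, y}"] sight_ge(1)[OF that(2,4), of "{x, y}"]
      unfolding pt[OF xy] by simp
    ultimately show False by simp
  qed
qed

end

subsection \<open>Coloring cycles with three colors\<close>

text \<open>The pattern \<open>abcab\<close> \<open>abcabc\<dots>\<close>; the initial block of length 5 is only needed for \<open>m \<equiv> 1\<close> modulo 3,
  where it leaves a rest of length 2 modulo 3. The shift is written \<open>i + 1\<close> since \<open>-5 \<equiv> 1\<close> modulo 3.\<close>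

definition cycle_color :: "nat \<Rightarrow> nat \<Rightarrow> nat" where
  "cycle_color m i = (if m mod 3 = 1 \<and> 5 \<le> i then i + 1 else i) mod 3"

lemma mod_wrap: "(a::nat) < 2 * m \<Longrightarrow> a mod m = (if a < m then a else a - m)"
  by (simp add: mod_if)

text \<open>For residue 1 the lengths 4 and 7 are excluded, so the first one is 10, with room for
  two blocks of length 5. The explicit offsets let \<open>simp\<close> evaluate colors near the
  wrap-around.\<close>

lemma cycle_length_cases:
  assumes "5 \<le> (m::nat)" "m \<noteq> 7"
  obtains q where "m = 3 * q + 5" | q where "m = 3 * q + 6" | q where "m = 3 * q + 10"
proof -
  have m: "m = 3 * (m div 3) + m mod 3" by simp
  consider "m mod 3 = 2" | "m mod 3 = 0" | "m mod 3 = 1" by linarith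
  then show thesis
  proof cases
    case 1
    then have "m = 3 * (m div 3 - 1) + 5" using m assms by linarith
    then show thesis by (rule that(1))
  next
    case 2
    then have "m = 3 * (m div 3 - 2) + 6" using m assms by linarith
    then show thesis by (rule that(2))
  next
    case 3
    then have "m div 3 \<noteq> 0" "m div 3 \<noteq> 1" "m div 3 \<noteq> 2" using m assms by force+
    then have "m = 3 * (m div 3 - 3) + 10" using m 3 by linarith
    then show thesis by (rule that(3))
  qed
qed

lemma cycle_color_Suc:
  assumes "5 \<le> m" "m \<noteq> 7" "i < m"
  shows "cycle_color m (Suc i mod m) \<noteq> cycle_color m i"
proof (cases "Suc i = m")
  case True
  then have "Suc i mod m = 0" "i = m - 1" by auto
  then show ?thesis
    by (cases rule: cycle_length_cases[OF assms(1,2)]) (auto simp: cycle_color_def mod_simps)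
next
  case False
  then have "Suc i mod m = Suc i" using assms(3) by simp
  then show ?thesis unfolding cycle_color_def by (auto simp: mod_Suc)
qed

text \<open>Excludes three edges of one color at spacing 2, the only way for the middle one to have
  two conflicts at distance 2.\<close>

lemma cycle_color_add2:
  assumes "5 \<le> m" "m \<noteq> 7" "i < m" "cycle_color m ((i + 2) mod m) = cycle_color m i"
  shows "cycle_color m ((i + 4) mod m) \<noteq> cycle_color m i"
proof -
  consider "i + 4 < m" | "i = m - 1" | "i = m - 2" | "i = m - 3" | "i = m - 4" using assms(3) by linarith
  then show ?thesis
  proof cases
    case 1
    then have "(i + 2) mod m = i + 2" "(i + 4) mod m = i + 4" by auto
    \<comment> \<open>A shift by 2 changes the residue, so equal colors here must straddle the seam
      between positions 4 and 5.\<close>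
    moreover have "n mod 3 \<noteq> (n + 2) mod 3" for n :: nat by presburger
    from this[of i] this[of "i + 1"] have "m mod 3 = 1" "i = 3 \<or> i = 4"
      using assms(4) \<open>(i + 2) mod m = i + 2\<close> by (auto simp: cycle_color_def split: if_splits)
    ultimately show ?thesis by (auto simp: cycle_color_def)
  next
    case 2
    then have *: "(i + 2) mod m = 1" "(i + 4) mod m = 3" using assms(1) by (auto simp: mod_wrap)
    show ?thesis
      using assms(4) unfolding * unfolding 2 cycle_color_def
      by (cases rule: cycle_length_cases[OF assms(1,2)]) (simp_all add: mod_Suc)
  next
    case 3
    then have *: "(i + 2) mod m = 0" "(i + 4) mod m = 2" using assms(1) by (auto simp: mod_wrap)
    show ?thesis
      using assms(4) unfolding * unfolding 3 cycle_color_def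
      by (cases rule: cycle_length_cases[OF assms(1,2)]) (simp_all add: mod_Suc)
  next
    case 4
    then have *: "(i + 2) mod m = m - 1" "(i + 4) mod m = 1" using assms(1) by (auto simp: mod_wrap)
    show ?thesis
      using assms(4) unfolding * unfolding 4 cycle_color_def
      by (cases rule: cycle_length_cases[OF assms(1,2)]) (simp_all add: mod_Suc)
  next
    case 5
    then have *: "(i + 2) mod m = m - 2" "(i + 4) mod m = 0" using assms(1) by (auto simp: mod_wrap)
    show ?thesis
      using assms(4) unfolding * unfolding 5 cycle_color_def
      by (cases rule: cycle_length_cases[OF assms(1,2)]) (simp_all add: mod_Suc)
  qed
qed

subsection \<open>Shortest cycles in a counterexample\<close>

definition is_cycle :: "'a set set \<Rightarrow> (nat \<Rightarrow> 'a) \<Rightarrow> nat \<Rightarrow> bool" where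
  "is_cycle E p m \<longleftrightarrow> 3 \<le> m \<and> inj_on p {..<m} \<and> (\<forall>i<m. {p i, p (Suc i mod m)} \<in> E)"

text \<open>Serves both to find a cycle from a longest path and to rule out chords of a shortest
  cycle.\<close>

lemma is_cycle_segment:
  assumes "inj_on p {..<n}" "\<And>i. Suc i < n \<Longrightarrow> {p i, p (Suc i)} \<in> E"
    and "Suc i < j" "j < n" "{p j, p i} \<in> E"
  shows "is_cycle E (\<lambda>t. p (i + t)) (Suc (j - i))"
  unfolding is_cycle_def
proof (intro conjI allI impI)
  show "inj_on (\<lambda>t. p (i + t)) {..<Suc (j - i)}"
    using assms by (intro inj_onI) (auto dest!: inj_onD)
  fix t assume t: "t < Suc (j - i)"
  show "{p (i + t), p (i + Suc t mod Suc (j - i))} \<in> E"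
  proof (cases "t = j - i")
    case True
    then show ?thesis using assms by simp
  next
    case False
    then show ?thesis using t assms(2)[of "i + t"] assms(4) by simp
  qed
qed (use assms in simp)

context finite_graph
begin

text \<open>The last vertex of a longest path has a second neighbor; by maximality it lies on the
  path, and the edge to it closes a cycle.\<close>

lemma ex_cycle:
  assumes "v \<in> V" and deg: "\<And>x. x \<in> V \<Longrightarrow> 2 \<le> degree E x"
  shows "\<exists>p m. is_cycle E p m"
proof -
  define P where "P n \<longleftrightarrow> (\<exists>p. inj_on p {..<n} \<and> p ` {..<n} \<subseteq> V \<and>
    (\<forall>i. Suc i < n \<longrightarrow> {p i, p (Suc i)} \<in> E))" for n
  have "n \<le> card V" if "P n" for n
  proof -
    obtain p where "inj_on p {..<n}" "p ` {..<n} \<subseteq> V" using \<open>P n\<close> P_def by auto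
    then show ?thesis using card_inj_on_le[of p "{..<n}" V] simple by (simp add: simple_graph_def)
  qed
  moreover have "P 1"
    unfolding P_def using assms(1) by (intro exI[of _ "\<lambda>_. v"]) (auto simp: inj_on_def)
  ultimately obtain n where "P n" and max: "\<And>l. P l \<Longrightarrow> l \<le> n" and "1 \<le> n"
    using Nat.ex_has_greatest_nat[of P 1 "card V"] by blast
  from \<open>P n\<close> obtain p where p: "inj_on p {..<n}" "p ` {..<n} \<subseteq> V"
    "\<And>i. Suc i < n \<Longrightarrow> {p i, p (Suc i)} \<in> E" unfolding P_def by auto
  define z where "z = p (n - 1)"
  have "z \<in> V" using p(2) \<open>1 \<le> n\<close> by (auto simp: z_def)
  \<comment> \<open>For \<open>n = 1\<close> truncated subtraction turns \<open>p (n - 2)\<close>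
    into \<open>z\<close> itself; the counting argument is unaffected.\<close>
  then have "\<not> nbrs E z \<subseteq> {p (n - 2)}"
    using deg[of z] card_mono[of "{p (n - 2)}" "nbrs E z"] by (auto simp: card_nbrs)
  then obtain x where x: "{z, x} \<in> E" "x \<noteq> p (n - 2)"
    unfolding subset_iff in_nbrs_iff singleton_iff by blast
  then have "x \<in> V" "x \<noteq> z" using edge_ends by blast+
  have "x \<in> p ` {..<n}"
  proof (rule ccontr)
    assume new: "x \<notin> p ` {..<n}"
    have "inj_on (p(n := x)) {..<Suc n}"
      using p(1) new by (auto simp: lessThan_Suc inj_on_def)
    moreover have "(p(n := x)) ` {..<Suc n} \<subseteq> V" using p(2) \<open>x \<in> V\<close> by auto
    moreover have "{(p(n := x)) i, (p(n := x)) (Suc i)} \<in> E" if "Suc i < Suc n" for i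
    proof (cases "Suc i = n")
      case True
      then show ?thesis using x(1) by (auto simp: z_def)
    next
      case False
      then show ?thesis using p(3)[of i] that by auto
    qed
    ultimately have "P (Suc n)" unfolding P_def by blast
    then show False using max[of "Suc n"] by simp
  qed
  then obtain i where i: "i < n" "x = p i" by auto
  \<comment> \<open>Hence \<open>i + 1 < n - 1\<close>, as \<open>is_cycle_segment\<close>
    demands.\<close>
  then have "i \<noteq> n - 1" "i \<noteq> n - 2" using x(2) \<open>x \<noteq> z\<close> by (auto simp: z_def)
  then have "is_cycle E (\<lambda>t. p (i + t)) (Suc (n - 1 - i))"
    using i x(1) p \<open>1 \<le> n\<close> by (intro is_cycle_segment[of p n]) (auto simp: z_def)
  then show ?thesis by blast
qed

end

text \<open>A counterexample to the bound, with \<open>C_7\<close> not yet excluded. The assumptions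
  are not contradictory: \<open>C_7\<close> itself satisfies them, so the goal inside is to show
  that nothing else does.\<close>

locale critical_graph = finite_graph V E for V :: "'a set" and E +
  assumes connected: "connected_graph V E"
    and max_degree_ge: "max_degree V E \<ge> 2"
    and uncolorable: "\<And>c. \<not> relaxed_strong_coloring E 0 1 ((max_degree V E)\<^sup>2 - 1) c"
begin

sublocale weighted_coloring E "edge_weight E" "(max_degree V E)\<^sup>2 - 1"
  by unfold_locales (rule finite_edges, rule edge_weight_sym, simp, rule sum_edge_weight_le)

lemma ex_edge: "\<exists>u v. {u, v} \<in> E"
proof -
  have "max_degree V E \<in> degree E ` V"
    using connected simple unfolding max_degree_def connected_graph_def simple_graph_def
    by (intro Max_in) auto
  then obtain v where "2 \<le> card (nbrs E v)" using max_degree_ge by (auto simp: card_nbrs)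
  then have "nbrs E v \<noteq> {}" by auto
  then show ?thesis by auto
qed

lemma walk: "u \<in> V \<Longrightarrow> v \<in> V \<Longrightarrow> (\<lambda>x y. {x, y} \<in> E)\<^sup>*\<^sup>* u v"
  using connected by (auto simp: connected_graph_def)

lemma hole_adjacent:
  assumes "hole \<phi> e" "f \<in> E" "x \<in> e" "x \<in> f" "e \<noteq> f"
  shows "hole (\<phi>(e := \<phi> f)) f"
  using assms(1,2) edge_weight_adjacent[OF assms(5,3,4)] by (rule hole_move)

text \<open>A coloring of minimum potential has some hole; by connectedness it can be walked to any
  edge.\<close>

lemma ex_hole_at:
  assumes "f \<in> E"
  shows "\<exists>\<phi>. hole \<phi> f"
proof -
  have "2 * 2 \<le> (max_degree V E)\<^sup>2"
    using mult_le_mono[OF max_degree_ge max_degree_ge] by (simp only: power2_eq_square)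
  then have "0 < (max_degree V E)\<^sup>2 - 1" by simp
  then have "\<exists>\<phi> e. hole \<phi> e"
  proof (rule ex_hole)
    fix \<phi> :: "'a set \<Rightarrow> nat"
    assume \<phi>: "\<phi> ` E \<subseteq> {..<(max_degree V E)\<^sup>2 - 1}"
    show "\<exists>e\<in>E. 2 \<le> cost \<phi> e (\<phi> e)"
    proof (rule ccontr)
      assume "\<not> ?thesis"
      then have "relaxed_strong_coloring E 0 1 ((max_degree V E)\<^sup>2 - 1) \<phi>"
        by (intro relaxed_strong_coloring_if_light[OF \<phi>]) (auto simp: cost_def not_le)
      then show False using uncolorable by blast
    qed
  qed
  then obtain \<phi> e where \<phi>: "hole \<phi> e" by blast
  obtain u v where "e = {u, v}" "u \<in> V"
    using hole_in[OF \<phi>] simple unfolding simple_graph_def by blast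
  with \<phi> have e: "hole \<phi> {u, v}" by simp
  \<comment> \<open>With \<open>f\<close> arbitrary, the induction hypothesis at \<open>y\<close>
    puts the hole on the walk edge \<open>{y, z}\<close>, from which it steps to any edge at
    \<open>z\<close>.\<close>
  have "\<exists>\<phi>. hole \<phi> f" if "f \<in> E" "x \<in> f" "(\<lambda>x y. {x, y} \<in> E)\<^sup>*\<^sup>* u x" for x f
    using that(3,1,2)
  proof (induction arbitrary: f rule: rtranclp_induct)
    case base
    then show ?case using hole_adjacent[OF e, of f u] e by (cases "f = {u, v}") auto
  next
    case (step y z)
    then obtain \<psi> where "hole \<psi> {y, z}" by blast
    then show ?case using hole_adjacent[of \<psi> "{y, z}" f z] step by (cases "f = {y, z}") auto
  qed
  moreover obtain x where "x \<in> f" "x \<in> V" using assms simple unfolding simple_graph_def by blast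
  ultimately show ?thesis using walk[OF \<open>u \<in> V\<close>] assms by blast
qed

lemma tight:
  assumes "{u, v} \<in> E"
  shows "degree E u = max_degree V E"
    and "{u, x} \<in> E \<Longrightarrow> {v, x} \<notin> E"
    and "{u, x} \<in> E \<Longrightarrow> {v, y} \<in> E \<Longrightarrow> x \<noteq> v \<Longrightarrow> y \<noteq> u \<Longrightarrow> {x, y} \<notin> E"
proof -
  obtain \<phi> where "hole \<phi> {u, v}" using ex_hole_at[OF assms] by blast
  note * = assms hole_tight(1)[OF this] max_degree_ge
  show "degree E u = max_degree V E"
    and "{u, x} \<in> E \<Longrightarrow> {v, x} \<notin> E"
    and "{u, x} \<in> E \<Longrightarrow> {v, y} \<in> E \<Longrightarrow> x \<noteq> v \<Longrightarrow> y \<noteq> u \<Longrightarrow> {x, y} \<notin> E"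
    using tight_edge[OF *] by blast+
qed

lemma regular:
  assumes "u \<in> V"
  shows "degree E u = max_degree V E"
proof -
  obtain a b where ab: "{a, b} \<in> E" using ex_edge by blast
  show ?thesis
  proof (cases "u = a")
    case True
    then show ?thesis using tight(1)[OF ab] by simp
  next
    case False
    have "(\<lambda>x y. {x, y} \<in> E)\<^sup>*\<^sup>* u a" using walk assms edge_ends[OF ab] by blast
    then obtain y where "{u, y} \<in> E" using False by (auto elim: converse_rtranclpE)
    then show ?thesis by (rule tight(1))
  qed
qed

lemma ex_shortest_cycle: "\<exists>p m. is_cycle E p m \<and> (\<forall>q l. is_cycle E q l \<longrightarrow> m \<le> l)"
proof -
  obtain u v where "{u, v} \<in> E" using ex_edge by blast
  then have "\<exists>p m. is_cycle E p m"
    using edge_ends[of u v] regular max_degree_ge by (intro ex_cycle[of u]) auto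
  then have "\<exists>m p. is_cycle E p m" by blast
  then show ?thesis using exists_least_iff[of "\<lambda>m. \<exists>p. is_cycle E p m"] by (metis not_le)
qed

end

section \<open>Geometry of a shortest cycle in a counterexample\<close>

locale critical_cycle = critical_graph V E for V :: "'a set" and E +
  fixes p :: "nat \<Rightarrow> 'a" and m :: nat
  assumes cycle: "is_cycle E p m" and shortest: "\<And>q l. is_cycle E q l \<Longrightarrow> m \<le> l"
begin

definition e :: "nat \<Rightarrow> 'a set" where
  "e i = {p i, p (Suc i mod m)}"

lemma m_ge_3: "3 \<le> m" using cycle by (simp add: is_cycle_def)

lemma Suc_mod: "i < m \<Longrightarrow> Suc i mod m = (if Suc i = m then 0 else Suc i)"
  by auto

lemma p_eq_iff: "i < m \<Longrightarrow> j < m \<Longrightarrow> p i = p j \<longleftrightarrow> i = j"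
  using cycle unfolding is_cycle_def by (auto dest: inj_onD)

lemma e_in [simp]: "i < m \<Longrightarrow> e i \<in> E"
  using cycle by (simp add: is_cycle_def e_def)

lemma e_eq_iff: "i < m \<Longrightarrow> j < m \<Longrightarrow> e i = e j \<longleftrightarrow> i = j"
  using m_ge_3 by (auto simp: e_def doubleton_eq_iff p_eq_iff Suc_mod split: if_splits)

lemma e_step: "Suc i < m \<Longrightarrow> e i = {p i, p (Suc i)}"
  by (simp add: e_def)

lemma chordless:
  assumes "i < m" "j < m"
  shows "{p i, p j} \<in> E \<longleftrightarrow> j = Suc i mod m \<or> i = Suc j mod m"
proof
  have step: "{p i, p (Suc i)} \<in> E" if "Suc i < m" for i
    using e_in[of i] that unfolding e_def by simp
  have aux: "j = Suc i mod m \<or> i = Suc j mod m" if "i < j" "j < m" "{p j, p i} \<in> E" for i j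
  proof (cases "Suc i = j")
    case True
    then show ?thesis using that by simp
  next
    case False
    have "inj_on p {..<m}" using cycle by (simp add: is_cycle_def)
    \<comment> \<open>A chord would close a cycle of length \<open>j - i + 1\<close>, shorter than
      \<open>m\<close> unless it is the closing edge.\<close>
    then have "m \<le> Suc (j - i)"
      using shortest[OF is_cycle_segment[of p m E i j]] that False step by simp
    then have "i = 0" "Suc j = m" using that by linarith+
    then show ?thesis by simp
  qed
  assume "{p i, p j} \<in> E"
  then show "j = Suc i mod m \<or> i = Suc j mod m"
    using aux[of i j] aux[of j i] assms edge_ends[of "p i" "p j"]
    by (metis insert_commute linorder_neqE_nat)
next
  assume "j = Suc i mod m \<or> i = Suc j mod m"
  then show "{p i, p j} \<in> E"
    using e_in[of i] e_in[of j] assms unfolding e_def by (metis insert_commute)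
qed

lemma m_ge_5: "5 \<le> m"
proof -
  have E: "{p i, p j} \<in> E" if "i < m" "j = Suc i mod m" for i j
    using e_in[OF that(1)] that(2) by (simp add: e_def)
  have "m \<noteq> 3"
  proof
    assume m: "m = 3"
    have "{p 0, p 1} \<in> E" "{p 1, p 2} \<in> E" "{p 2, p 0} \<in> E" by (intro E; simp add: m)+
    then show False using tight(2)[of "p 0" "p 1" "p 2"] by (simp add: insert_commute)
  qed
  moreover have "m \<noteq> 4"
  proof
    assume m: "m = 4"
    have "{p 0, p 1} \<in> E" "{p 1, p 2} \<in> E" "{p 2, p 3} \<in> E" "{p 3, p 0} \<in> E" by (intro E; simp add: m)+
    then show False using tight(3)[of "p 0" "p 1" "p 3" "p 2"] p_eq_iff[of 1 3] p_eq_iff[of 0 2] m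
      by (simp add: insert_commute)
  qed
  ultimately show ?thesis using m_ge_3 by simp
qed

lemma e_explicit: "e 0 = {p 0, p 1}" "e 1 = {p 1, p 2}" "e 2 = {p 2, p 3}"
  "e (m - 1) = {p (m - 1), p 0}" "e (m - 2) = {p (m - 2), p (m - 1)}"
proof -
  have *: "Suc 1 = 2" "Suc 2 = 3" "Suc (m - 2) = m - 1" "Suc (m - 1) = m" using m_ge_5 by auto
  show "e 0 = {p 0, p 1}" "e 1 = {p 1, p 2}" "e 2 = {p 2, p 3}"
    "e (m - 2) = {p (m - 2), p (m - 1)}"
    using m_ge_5 e_step[of 0] e_step[of 1] e_step[of 2] e_step[of "m - 2"] unfolding * by auto
  show "e (m - 1) = {p (m - 1), p 0}" unfolding e_def * by simp
qed

lemma edge_dist1_e: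
  assumes "i < m" "j < m" "edge_dist1 (e i) (e j)"
  shows "j = Suc i mod m \<or> i = Suc j mod m"
  using assms m_ge_3 unfolding edge_dist1_def
  by (auto simp: e_def doubleton_eq_iff p_eq_iff Suc_mod split: if_splits)

text \<open>These are the only cycle edges that \<open>e 0\<close> sees; the four are distinct since
  \<open>5 \<le> m\<close>.\<close>

lemma edge_weight_e0:
  shows "edge_weight E (e 0) (e 1) = 2" and "edge_weight E (e 0) (e 2) = 1"
    and "edge_weight E (e 0) (e (m - 1)) = 2" and "edge_weight E (e 0) (e (m - 2)) = 1"
    and "i < m \<Longrightarrow> i \<noteq> 1 \<Longrightarrow> i \<noteq> 2 \<Longrightarrow> i \<noteq> m - 1 \<Longrightarrow> i \<noteq> m - 2 \<Longrightarrow> edge_weight E (e 0) (e i) = 0"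
proof -
  have E: "{p 1, p 2} \<in> E" "{p 0, p (m - 1)} \<in> E"
    using m_ge_5 by (auto simp: chordless Suc_mod)
  show "edge_weight E (e 0) (e 1) = 2" "edge_weight E (e 0) (e (m - 1)) = 2"
    using m_ge_5 unfolding e_explicit by (auto simp: edge_weight_def edge_dist1_def doubleton_eq_iff p_eq_iff)
  show "edge_weight E (e 0) (e 2) = 1"
    using m_ge_5 E unfolding e_explicit by (auto simp: edge_weight_def edge_dist1_def edge_dist2_def doubleton_eq_iff p_eq_iff
        intro!: bexI[of _ "{p 1, p 2}"])
  show "edge_weight E (e 0) (e (m - 2)) = 1"
    using m_ge_5 E unfolding e_explicit by (auto simp: edge_weight_def edge_dist1_def edge_dist2_def doubleton_eq_iff p_eq_iff
        intro!: bexI[of _ "{p 0, p (m - 1)}"])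
  assume i: "i < m" "i \<noteq> 1" "i \<noteq> 2" "i \<noteq> m - 1" "i \<noteq> m - 2"
  show "edge_weight E (e 0) (e i) = 0"
  proof (cases "i = 0")
    case False
    then have i': "3 \<le> i" "Suc (Suc i) < m" using i by linarith+
    then have ei: "e i = {p i, p (Suc i)}" using i by (auto simp: e_def Suc_mod)
    have "\<not> edge_dist1 (e 0) (e i)"
      using edge_dist1_e[of 0 i] i m_ge_5 False by (auto simp: Suc_mod split: if_splits)
    moreover have "\<not> edge_dist2 E (e 0) (e i)"
    proof
      assume "edge_dist2 E (e 0) (e i)"
      \<comment> \<open>The connecting edge would join an end of \<open>e 0\<close> to a
        non-consecutive vertex of the cycle, contrary to \<open>chordless\<close>.\<close>
      then obtain g x y where g: "g \<in> E" "x \<in> g" "x \<in> e 0" "y \<in> g" "y \<in> e i" "x \<noteq> y"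
        unfolding edge_dist2_def by auto
      then have "{x, y} \<in> E" by (metis edge_cases insertE singletonD)
      moreover obtain a where "a = 0 \<or> a = 1" "x = p a" using g by (auto simp: e_explicit)
      moreover obtain b where "b = i \<or> b = Suc i" "y = p b" using g ei by auto
      ultimately show False
        using chordless[of a b] i' by (auto simp: Suc_mod split: if_splits)
    qed
    ultimately show ?thesis by (simp add: edge_weight_def)
  qed simp
qed

section \<open>Moving a hole around the cycle\<close>

lemma hole_shift:
  assumes "hole \<phi> (e 0)" "j < m"
  shows "\<exists>\<psi>. hole \<psi> (e j) \<and> (\<forall>i<j. \<psi> (e i) = \<phi> (e (Suc i))) \<and> (\<forall>f. f \<notin> e ` {..<j} \<longrightarrow> \<psi> f = \<phi> f)"
  using assms(2)
proof (induction j)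
  case 0
  then show ?case using assms(1) by auto
next
  case (Suc j)
  then obtain \<psi> where \<psi>: "hole \<psi> (e j)" "\<And>i. i < j \<Longrightarrow> \<psi> (e i) = \<phi> (e (Suc i))"
    "\<And>f. f \<notin> e ` {..<j} \<Longrightarrow> \<psi> f = \<phi> f" by auto
  \<comment> \<open>The next edge has not been visited, so it passes on its original color.\<close>
  have "e (Suc j) \<notin> e ` {..<j}" using Suc.prems by (auto simp: e_eq_iff)
  then have *: "\<psi> (e (Suc j)) = \<phi> (e (Suc j))" by (rule \<psi>(3))
  have "hole (\<psi>(e j := \<psi> (e (Suc j)))) (e (Suc j))"
    using \<psi>(1) Suc.prems by (intro hole_adjacent[where x = "p (Suc j)"]) (auto simp: e_eq_iff, auto simp: e_def)
  moreover have "(\<psi>(e j := \<psi> (e (Suc j)))) (e i) = \<phi> (e (Suc i))" if "i < Suc j" for i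
    using that Suc.prems * \<psi>(2)[of i] by (auto simp: e_eq_iff less_Suc_eq)
  moreover have "(\<psi>(e j := \<psi> (e (Suc j)))) f = \<phi> f" if "f \<notin> e ` {..<Suc j}" for f
    using that \<psi>(3)[of f] by (auto simp: lessThan_Suc)
  ultimately show ?case by blast
qed

text \<open>The last move gives \<open>e (m - 1)\<close> the color which \<open>e 0\<close> took
  from \<open>e 1\<close> at the start, so the colors off the hole are rotated cyclically. The color
  at the hole itself is irrelevant for costs at \<open>e 0\<close>.\<close>

lemma hole_rotate:
  assumes "hole \<phi> (e 0)"
  obtains \<psi> where "hole \<psi> (e 0)" "\<forall>i. 1 \<le> i \<longrightarrow> i < m - 1 \<longrightarrow> \<psi> (e i) = \<phi> (e (Suc i))"
    "\<psi> (e (m - 1)) = \<phi> (e 1)" "\<forall>f. f \<notin> e ` {..<m} \<longrightarrow> \<psi> f = \<phi> f"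
proof -
  have m: "m - 1 < m" "Suc (m - 1) = m" using m_ge_3 by auto
  obtain \<psi> where \<psi>: "hole \<psi> (e (m - 1))" "\<And>i. i < m - 1 \<Longrightarrow> \<psi> (e i) = \<phi> (e (Suc i))"
    "\<And>f. f \<notin> e ` {..<m - 1} \<Longrightarrow> \<psi> f = \<phi> f" using hole_shift[OF assms m(1)] by blast
  let ?\<chi> = "\<psi>(e (m - 1) := \<psi> (e 0))"
  have "hole ?\<chi> (e 0)"
    using \<psi>(1) m_ge_3 m by (intro hole_adjacent[where x = "p 0"]) (auto simp: e_eq_iff, auto simp: e_def)
  have "?\<chi> (e i) = \<phi> (e (Suc i))" if "1 \<le> i" "i < m - 1" for i
    using that \<psi>(2)[of i] m_ge_3 by (auto simp: e_eq_iff)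
  have "?\<chi> (e (m - 1)) = \<phi> (e 1)" using \<psi>(2)[of 0] m_ge_3 by simp
  have "?\<chi> f = \<phi> f" if "f \<notin> e ` {..<m}" for f
  proof -
    have "e ` {..<m} = insert (e (m - 1)) (e ` {..<m - 1})"
      using lessThan_Suc[of "m - 1"] m(2) by simp
    then show ?thesis using that \<psi>(3)[of f] by simp
  qed
  show thesis by (rule that[of ?\<chi>]; (intro allI impI)?; fact)
qed

text \<open>Compares the costs of the color of \<open>e 2\<close> at \<open>e 0\<close> before and after the rotation.\<close>

lemma hole_colors:
  assumes "hole \<phi> (e 0)"
  shows "\<phi> (e (m - 2)) = \<phi> (e 2)"
proof -
  obtain \<psi> where \<psi>: "hole \<psi> (e 0)" "\<forall>i. 1 \<le> i \<longrightarrow> i < m - 1 \<longrightarrow> \<psi> (e i) = \<phi> (e (Suc i))"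
    "\<psi> (e (m - 1)) = \<phi> (e 1)" "\<forall>f. f \<notin> e ` {..<m} \<longrightarrow> \<psi> f = \<phi> f"
    by (rule hole_rotate[OF assms])
  define c where "c = \<phi> (e 2)"
  define A where "A = {e 1, e 2, e (m - 1), e (m - 2)}"
  have A: "A \<subseteq> E" using m_ge_5 by (auto simp: A_def)
  have ne: "e 1 \<noteq> e 2" "e 1 \<noteq> e (m - 1)" "e 1 \<noteq> e (m - 2)" "e 2 \<noteq> e (m - 1)"
    "e 2 \<noteq> e (m - 2)" "e (m - 1) \<noteq> e (m - 2)" using m_ge_5 by (auto simp: e_eq_iff)
  then have sum_A: "sum h A = h (e 1) + h (e 2) + h (e (m - 1)) + h (e (m - 2))" for h :: "'a set \<Rightarrow> nat"
    by (simp add: A_def del: One_nat_def)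
  have split: "cost \<theta> (e 0) c = (\<Sum>f\<in>E-A. if \<theta> f = c then edge_weight E (e 0) f else 0) +
      (if \<theta> (e 1) = c then 2 else 0) + (if \<theta> (e 2) = c then 1 else 0) +
      (if \<theta> (e (m - 1)) = c then 2 else 0) + (if \<theta> (e (m - 2)) = c then 1 else 0)" for \<theta>
  proof -
    have "(\<Sum>f\<in>A. if \<theta> f = c then edge_weight E (e 0) f else 0) =
      (if \<theta> (e 1) = c then 2 else 0) + (if \<theta> (e 2) = c then 1 else 0) +
      (if \<theta> (e (m - 1)) = c then 2 else 0) + (if \<theta> (e (m - 2)) = c then 1 else 0)"
      by (simp add: sum_A edge_weight_e0(1-4) del: One_nat_def)
    then show ?thesis
      unfolding cost_def using sum.subset_diff[OF A finite_E] by (metis (no_types, lifting) add.assoc)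
  qed
  \<comment> \<open>Outside \<open>A\<close>, edges of the cycle have weight 0 and all others keep
    their color.\<close>
  have "(if \<psi> f = c then edge_weight E (e 0) f else 0) = (if \<phi> f = c then edge_weight E (e 0) f else 0)"
    if "f \<in> E - A" for f
  proof (cases "f \<in> e ` {..<m}")
    case True
    then obtain i where "i < m" "f = e i" by auto
    moreover have "i \<noteq> 1" "i \<noteq> 2" "i \<noteq> m - 1" "i \<noteq> m - 2"
      using that \<open>f = e i\<close> unfolding A_def by blast+
    ultimately have "edge_weight E (e 0) f = 0" using edge_weight_e0(5)[of i] by simp
    then show ?thesis by simp
  qed (simp add: \<psi>(4))
  then have rest: "(\<Sum>f\<in>E-A. if \<psi> f = c then edge_weight E (e 0) f else 0) =
      (\<Sum>f\<in>E-A. if \<phi> f = c then edge_weight E (e 0) f else 0)" by simp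
  have "c < (max_degree V E)\<^sup>2 - 1" unfolding c_def using m_ge_5 by (intro hole_lt[OF assms]) simp
  then have "cost \<phi> (e 0) c = 2" "cost \<psi> (e 0) c = 2" using assms \<psi>(1) hole_tight(2) by blast+
  moreover have "\<psi> (e 1) = c" using \<psi>(2)[rule_format, of 1] m_ge_5 by (simp add: c_def numeral_2_eq_2)
  moreover have "\<psi> (e (m - 2)) = \<phi> (e (m - 1))"
    using \<psi>(2)[rule_format, of "m - 2"] m_ge_5 by (simp add: Suc_diff_Suc numeral_2_eq_2)
  \<comment> \<open>After the rotation \<open>e 1\<close> alone uses up the cost 2, so edges outside
    \<open>A\<close> contribute nothing. Before it, \<open>e 2\<close> contributes 1, and the
    missing 1 can only come from \<open>e (m - 2)\<close>.\<close>
  ultimately show ?thesis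
    unfolding split rest using \<psi>(3) by (auto simp: c_def split: if_splits)
qed

lemma max_degree_eq_2: "max_degree V E = 2"
proof (rule ccontr)
  assume "max_degree V E \<noteq> 2"
  then have "3 \<le> max_degree V E" using max_degree_ge by simp
  note e = e_explicit
  have eE: "e 0 \<in> E" "e 1 \<in> E" "e 2 \<in> E" using m_ge_5 by auto
  have "card (nbrs E (p 2)) \<ge> 3"
    using \<open>3 \<le> _\<close> eE(3) e edge_ends regular by (simp add: card_nbrs)
  then have "\<not> nbrs E (p 2) \<subseteq> {p 1, p 3}"
    using card_mono[of "{p 1, p 3}" "nbrs E (p 2)"] card_insert_le_m1[of 2 "{p 3}" "p 1"] by auto
  then obtain x where x: "{p 2, x} \<in> E" "x \<noteq> p 1" "x \<noteq> p 3"
    unfolding subset_iff in_nbrs_iff insert_iff empty_iff by blast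
  define g where "g = {p 2, x}"
  have ne_g: "g \<noteq> e 0" "g \<noteq> e 1" "g \<noteq> e 2" "g \<noteq> e (m - 2)"
    using x m_ge_5 unfolding g_def e by (auto simp: doubleton_eq_iff p_eq_iff)
  have ne_e: "e 0 \<noteq> e 1" "e 0 \<noteq> e 2" "e 1 \<noteq> e 2"
    "e (m - 2) \<noteq> e 0" "e (m - 2) \<noteq> e 1" "e (m - 2) \<noteq> e 2"
    using m_ge_5 by (auto simp: e_eq_iff)
  note ne = ne_g ne_e
  obtain \<phi> where \<phi>: "hole \<phi> (e 0)" using ex_hole_at[OF eE(1)] by blast
  \<comment> \<open>The detour over \<open>g\<close> leaves \<open>e (m - 2)\<close> untouched but
    gives \<open>e 2\<close> the color of \<open>g\<close>, so applying \<open>hole_colors\<close>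
    at both ends yields equal colors on \<open>e 2\<close> and \<open>g\<close>.\<close>
  define \<phi>1 where "\<phi>1 = \<phi>(e 0 := \<phi> (e 1))"
  define \<phi>2 where "\<phi>2 = \<phi>1(e 1 := \<phi>1 (e 2))"
  define \<phi>3 where "\<phi>3 = \<phi>2(e 2 := \<phi>2 g)"
  define \<phi>4 where "\<phi>4 = \<phi>3(g := \<phi>3 (e 1))"
  define \<phi>5 where "\<phi>5 = \<phi>4(e 1 := \<phi>4 (e 0))"
  have 1: "hole \<phi>1 (e 1)" unfolding \<phi>1_def
    using ne by (intro hole_adjacent[OF \<phi> eE(2), of "p 1"]) (auto simp: e simp del: One_nat_def)
  have 2: "hole \<phi>2 (e 2)" unfolding \<phi>2_def
    using ne by (intro hole_adjacent[OF 1 eE(3), of "p 2"]) (auto simp: e simp del: One_nat_def)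
  have 3: "hole \<phi>3 g" unfolding \<phi>3_def
    using ne x by (intro hole_adjacent[OF 2, of g "p 2"]) (auto simp: e g_def simp del: One_nat_def)
  have 4: "hole \<phi>4 (e 1)" unfolding \<phi>4_def
    using ne by (intro hole_adjacent[OF 3 eE(2), of "p 2"]) (auto simp: e g_def simp del: One_nat_def)
  have 5: "hole \<phi>5 (e 0)" unfolding \<phi>5_def
    using ne by (intro hole_adjacent[OF 4 eE(1), of "p 1"]) (auto simp: e simp del: One_nat_def)
  have "\<phi>5 (e 2) = \<phi> g" "\<phi>5 (e (m - 2)) = \<phi> (e (m - 2))"
    using ne ne[symmetric] by (auto simp: \<phi>5_def \<phi>4_def \<phi>3_def \<phi>2_def \<phi>1_def)
  then have "\<phi> (e 2) = \<phi> g" using hole_colors[OF \<phi>] hole_colors[OF 5] by simp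
  \<comment> \<open>In \<open>\<phi>1\<close> the hole is at \<open>e 1\<close>, adjacent to both
    \<open>e 2\<close> and \<open>g\<close>; their common color would cost 4 there.\<close>
  then have "\<phi>1 (e 2) = \<phi> g" "\<phi>1 g = \<phi> g"
    using ne(1) ne(6) by (simp_all add: \<phi>1_def)
  moreover have "{e 2, g} \<subseteq> E" using x(1) eE(3) by (simp add: g_def)
  ultimately have "(\<Sum>f\<in>{e 2, g}. edge_weight E (e 1) f) \<le> 2"
    by (intro hole_weight_le[OF 1, of _ "\<phi> g"]) auto
  moreover have "edge_weight E (e 1) (e 2) = 2"
    by (rule edge_weight_adjacent[of _ _ "p 2"]) (use ne(7) in \<open>simp_all add: e del: One_nat_def\<close>)
  moreover have "edge_weight E (e 1) g = 2"
    by (rule edge_weight_adjacent[of _ _ "p 2"]) (use ne(2) in \<open>simp_all add: e g_def del: One_nat_def\<close>)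
  ultimately show False using ne(3) by simp
qed

section \<open>Maximum degree 2: the shortest cycle is the whole graph\<close>

lemma in_cycle:
  assumes "x \<in> V"
  shows "x \<in> p ` {..<m}"
proof -
  have "p 0 \<in> V" using e_in[of 0] edge_ends m_ge_3 unfolding e_def by auto
  then have "(\<lambda>x y. {x, y} \<in> E)\<^sup>*\<^sup>* (p 0) x" using walk assms by blast
  then show ?thesis
  proof (induction rule: rtranclp_induct)
    case base
    then show ?case using m_ge_3 by auto
  next
    case (step y z)
    then obtain i where i: "i < m" "y = p i" by auto
    \<comment> \<open>The cyclic predecessor of \<open>i\<close>; together with the successor it
      exhausts the two neighbors of \<open>p i\<close>, so no edge leaves the cycle.\<close>
    define j where "j = (if i = 0 then m - 1 else i - 1)"
    have j: "j < m" "Suc j mod m = i" "j \<noteq> Suc i mod m"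
      using i m_ge_3 by (auto simp: j_def Suc_mod)
    then have "{p j, p (Suc i mod m)} \<subseteq> nbrs E y"
      using i by (auto simp: chordless)
    moreover have "card {p j, p (Suc i mod m)} = 2" using j by (simp add: p_eq_iff)
    moreover have "card (nbrs E y) = 2"
      using step(2) edge_ends regular max_degree_eq_2 by (simp add: card_nbrs)
    ultimately have "nbrs E y = {p j, p (Suc i mod m)}" by (metis card_subset_eq finite_nbrs)
    then show ?case using step(2) j(1) by auto
  qed
qed

lemma V_eq: "V = p ` {..<m}"
  using in_cycle e_in edge_ends unfolding e_def by blast

lemma E_eq: "E = e ` {..<m}"
proof
  show "E \<subseteq> e ` {..<m}"
  proof
    fix f assume "f \<in> E"
    then obtain u v where f: "f = {u, v}" "u \<in> V" "v \<in> V" using simple unfolding simple_graph_def by blast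
    then obtain i j where ij: "i < m" "j < m" "u = p i" "v = p j" unfolding V_eq by auto
    then have "f = e i \<or> f = e j" using \<open>f \<in> E\<close> f chordless[of i j] by (auto simp: e_def)
    then show "f \<in> e ` {..<m}" using ij by auto
  qed
qed auto

lemma isomorphic: "isomorphic_to_cycle V E m"
  unfolding isomorphic_to_cycle_def graph_iso_def
proof (intro exI conjI ballI)
  let ?f = "inv_into {..<m} p"
  have inj: "inj_on p {..<m}" using cycle by (simp add: is_cycle_def)
  then show "bij_betw ?f V {0..<m}"
    unfolding V_eq atLeast0LessThan by (intro bij_betw_inv_into) (simp add: bij_betw_def)
  fix u v assume "u \<in> V" "v \<in> V"
  then obtain i j where ij: "i < m" "j < m" "u = p i" "v = p j" unfolding V_eq by auto
  have "{i, j} \<in> cycle_edges m \<longleftrightarrow> j = Suc i mod m \<or> i = Suc j mod m"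
    using ij by (auto simp: cycle_edges_def doubleton_eq_iff)
  then show "{u, v} \<in> E \<longleftrightarrow> {?f u, ?f v} \<in> cycle_edges m"
    using ij inj by (simp add: chordless)
qed

text \<open>Two steps along the cycle either cancel, which \<open>i \<noteq> j\<close> forbids, or
  add up to a shift by 2.\<close>

lemma edge_dist2_e:
  assumes "i < m" "j < m" "edge_dist2 E (e i) (e j)"
  shows "j = (i + 2) mod m \<or> i = (j + 2) mod m"
proof -
  obtain t where "t < m" "e t \<inter> e i \<noteq> {}" "e t \<inter> e j \<noteq> {}"
    using assms(3) unfolding edge_dist2_def E_eq by auto
  moreover have "e i \<inter> e j = {}" "i \<noteq> j" using assms(3) by (auto simp: edge_dist2_def)
  ultimately have "edge_dist1 (e i) (e t)" "edge_dist1 (e t) (e j)"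
    by (auto simp: edge_dist1_def)
  then show ?thesis
    using edge_dist1_e[of i t] edge_dist1_e[of t j] assms(1,2) \<open>t < m\<close> \<open>i \<noteq> j\<close>
      mod_wrap[of "i + 2" m] mod_wrap[of "j + 2" m] m_ge_5
    by (auto simp: Suc_mod split: if_splits)
qed

lemma m_eq_7: "m = 7"
proof (rule ccontr)
  assume "m \<noteq> 7"
  define c where "c f = cycle_color m (inv_into {..<m} e f)" for f
  have "inj_on e {..<m}" by (auto simp: inj_on_def e_eq_iff)
  then have c [simp]: "c (e i) = cycle_color m i" if "i < m" for i
    using that by (simp add: c_def)
  note col = cycle_color_Suc[OF m_ge_5 \<open>m \<noteq> 7\<close>] cycle_color_add2[OF m_ge_5 \<open>m \<noteq> 7\<close>]
  have "relaxed_strong_coloring E 0 1 3 c"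
    unfolding relaxed_strong_coloring_def
  proof (intro conjI ballI)
    fix f assume "f \<in> E"
    then obtain i where i: "i < m" "f = e i" unfolding E_eq by auto
    show "c f < 3" using i by (simp add: cycle_color_def)
    have "{g \<in> E. edge_dist1 f g \<and> c g = c f} = {}"
      unfolding E_eq i(2) using i(1) edge_dist1_e[OF i(1)] col(1) by fastforce
    then show "card {g \<in> E. edge_dist1 f g \<and> c g = c f} \<le> 0" by (simp only: card.empty)
    \<comment> \<open>Only indices \<open>i - 2\<close> and \<open>i + 2\<close> are possible. If
      both had the color of \<open>i\<close>, three equal colors at spacing 2 would start at
      \<open>i - 2\<close>, against \<open>cycle_color_add2\<close>.\<close>
    have unique: "e j = e k" if "j < m" "k < m" "edge_dist2 E (e i) (e j)" "edge_dist2 E (e i) (e k)"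
      "cycle_color m j = cycle_color m i" "cycle_color m k = cycle_color m i" for j k
    proof -
      have no: False if "j < m" "i = (j + 2) mod m" "k = (i + 2) mod m"
        "cycle_color m j = cycle_color m i" "cycle_color m k = cycle_color m i" for j k
      proof -
        have "k = (j + 2 + 2) mod m" unfolding that(2,3) by (rule mod_add_left_eq)
        then have "k = (j + 4) mod m" by (simp only: add.assoc) simp
        then show False using col(2)[of j] that by auto
      qed
      have eq: "j = k" if "j < m" "k < m" "(j + 2) mod m = (k + 2) mod m" for j k
        using that mod_wrap[of "j + 2" m] mod_wrap[of "k + 2" m] m_ge_5 by (auto split: if_splits)
      show ?thesis
        using edge_dist2_e[OF i(1) \<open>j < m\<close>] edge_dist2_e[OF i(1) \<open>k < m\<close>] no[of j k] no[of k j] eq[of j k] that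
        by metis
    qed
    have "g = h" if "g \<in> E" "h \<in> E" "edge_dist2 E f g" "edge_dist2 E f h" "c g = c f" "c h = c f" for g h
    proof -
      obtain j k where "j < m" "g = e j" "k < m" "h = e k" using \<open>g \<in> E\<close> \<open>h \<in> E\<close> E_eq by auto
      then show ?thesis using unique[of j k] that(3-6) i by simp
    qed
    then show "card {g \<in> E. edge_dist2 E f g \<and> c g = c f} \<le> 1"
      using finite_E by (simp add: card_le_Suc0_iff_eq)
  qed
  then show False using uncolorable[of c] max_degree_eq_2 by (simp add: power2_eq_square)
qed

end

theorem theorem3:
  fixes V :: "'a set" and E :: "'a set set"
  assumes "simple_graph V E"
    and "connected_graph V E"
    and "max_degree V E \<ge> 2"
    and "\<not> isomorphic_to_cycle V E 7"
  shows "relaxed_strong_chromatic_index E 0 1 \<le> (max_degree V E)\<^sup>2 - 1"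
proof -
  have "\<exists>c. relaxed_strong_coloring E 0 1 ((max_degree V E)\<^sup>2 - 1) c"
  proof (rule ccontr)
    assume "\<nexists>c. relaxed_strong_coloring E 0 1 ((max_degree V E)\<^sup>2 - 1) c"
    then interpret critical_graph V E
      using assms by unfold_locales auto
    obtain p m where "is_cycle E p m" "\<And>q l. is_cycle E q l \<Longrightarrow> m \<le> l"
      using ex_shortest_cycle by blast
    then interpret critical_cycle V E p m by unfold_locales
    show False using isomorphic m_eq_7 assms(4) by simp
  qed
  then show ?thesis unfolding relaxed_strong_chromatic_index_def by (rule Least_le)
qed

end
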